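(* Let $p^h\in U^h$ and $q_D(\Omega)\in G^h$ satisfy $$d(p^h,v^h)-(q_D(\Omega),v^h)_{\Gamma_D}=f(v^h)\qquad\text{for all } v^h\in S^h,$$ where $S^h$ is the low-order continuous finite element space on a (possibly non-conforming, $1$-irregular) mesh of $\Omega$. Then the finite element method is globally conservative with respect to the flux $q_D(\Omega)$ associated with the Dirichlet boundary, i.e. $$\int_{\Gamma_D} q_D(\Omega)\,\mathrm d\Gamma+\int_{\Gamma_N} h\,\mathrm d\Gamma=0 .$$
   Context: Domain and data: $\Omega\subset\mathbb R^d$, $d\in\{2,3\}$, is an axis-aligned box, whose boundary is decomposed as $\partial\Omega=\overline\Gamma_D\cup\overline\Gamma_N$, where $\Gamma_D$ and $\Gamma_N$ have disjoint interiors. $\Omega$ is split into a fracture part $\Omega_f$ (a finite union of boxes contained in $\Omega$) and a matrix part $\Omega_m=\Omega\setminus\Omega_f$. The permeability $k$ is a positive function equal to a constant $k_m>0$ in $\Omega_m$ and to a constant $k_f>0$ in $\Omega_f$. The flow problem is $\nabla\cdot(-k\nabla p)=0$ in $\Omega$, $p=g$ on $\Gamma_D$, $k\nabla p\cdot n=h$ on $\Gamma_N$, where $n$ is the outward unit normal. Here $h$ (not to be confused with the superscript $h$ marking discrete objects) is a given Neumann datum, square integrable on $\Gamma_N$. Put $$d(p,v)=\int_\Omega k\,\nabla p\cdot\nabla v\,\mathrm dV,\qquad f(v)=\int_{\Gamma_N}h\,v\,\mathrm d\Gamma,$$ and let $(\cdot,\cdot)_{\Gamma_D}$ be the $L^2(\Gamma_D)$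 scalar product. Mesh: $\mathcal T$ is a mesh of $\Omega$ whose elements are all of the same type (triangles or quadrilaterals for $d=2$; tetrahedra or hexahedra for $d=3$). The mesh may be non-conforming: a vertex of one element may lie in the interior of an edge or a face of another element; such a vertex is called hanging, and all other vertices are called regular. The mesh is $1$-irregular: the interior of an edge or face contains at most one hanging vertex, which is the center of that edge or face. Let $J^r$ be the index set of the regular vertices $\mathbf x_i$. Discrete spaces: $\mathbb L_1$ denotes the linear functions on an element (triangles, tetrahedra) or the multilinear functions (quadrilaterals, hexahedra). $S^h=\{v\in C^0(\Omega): v|_E\in\mathbb L_1\text{ for every element }E\}$, which is spanned by the conforming Lagrangian basis functions $N^r_i\in S^h$, $i\in J^r$, characterized by $N^r_i(\mathbf x_j)=\delta_{ij}$ for $i,j\in J^r$. Let $D=\{i\in J^r:\mathbf x_i\in\Gamma_D\}$. Then $U^h=\{v\in S^h: v=g\text{ on }\Gamma_D\}$ and $G^h=\mathrm{span}\{N^r_i\}_{i\in D}$. *)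

theory Defs
  imports "HOL-Analysis.Analysis"
begin

section \<open>Domain and boundary\<close>

text \<open>Boxes need not be axis-aligned here, and may contain any part of their boundary, so that
  a box may touch the boundary of an open set it is contained in.\<close>

definition is_box :: "(real^'n) set \<Rightarrow> bool" where
  "is_box B \<longleftrightarrow> (\<exists>(Q :: real^'n \<Rightarrow> real^'n) l u. orthogonal_transformation Q \<and> (\<forall>i. l $ i < u $ i) \<and>
     Q ` box l u \<subseteq> B \<and> B \<subseteq> Q ` cbox l u)"

definition boundary_decomposition ::
    "(real^'n) set \<Rightarrow> (real^'n) set \<Rightarrow> (real^'n) set \<Rightarrow> bool" where
  "boundary_decomposition \<Omega> \<Gamma>\<^sub>D \<Gamma>\<^sub>N \<longleftrightarrow>
     \<Gamma>\<^sub>D \<subseteq> frontier \<Omega> \<and> \<Gamma>\<^sub>N \<subseteq> frontier \<Omega> \<and>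
     frontier \<Omega> = closure \<Gamma>\<^sub>D \<union> closure \<Gamma>\<^sub>N \<and>
     (top_of_set (frontier \<Omega>)) interior_of \<Gamma>\<^sub>D \<inter> (top_of_set (frontier \<Omega>)) interior_of \<Gamma>\<^sub>N = {}"

text \<open>The surface measure on the boundary of \<open>box a b\<close>. The face on which the \<open>i\<close>-th coordinate
  equals \<open>a $ i\<close> or \<open>b $ i\<close> carries the \<open>(d-1)\<close>-dimensional Lebesgue measure, obtained by projecting
  the \<open>d\<close>-dimensional Lebesgue measure on \<open>cbox a b\<close> onto the face along the \<open>i\<close>-th axis and
  dividing by the length \<open>b $ i - a $ i\<close> of the fibres.\<close>

definition face_proj :: "real^'n \<Rightarrow> real^'n \<Rightarrow> 'n \<Rightarrow> bool \<Rightarrow> real^'n \<Rightarrow> real^'n" where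
  "face_proj a b i upper y =
     (\<chi> j. if j = i then (if upper then b $ i else a $ i) else y $ j)"

definition surface_measure :: "real^'n \<Rightarrow> real^'n \<Rightarrow> (real^'n) measure" where
  "surface_measure a b = completion (distr
     (density (count_space (UNIV :: ('n \<times> bool) set) \<Otimes>\<^sub>M lborel)
        (\<lambda>((i, upper), y). ennreal (indicator (cbox a b) y / (b $ i - a $ i))))
     borel
     (\<lambda>((i, upper), y). face_proj a b i upper y))"

section \<open>Meshes\<close>

text \<open>\<open>Simplicial\<close> stands for triangles and tetrahedra, \<open>Tensorial\<close> for quadrilaterals and
  hexahedra. An element is represented by its map \<open>F\<close> from the reference element (unit simplex or
  unit cube), that is, by \<open>F ` reference_element\<close> together with a numbering of its vertices. \<open>F\<close> is
  affine for simplices and multilinear for quadrilaterals and hexahedra.\<close>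

datatype element_type = Simplicial | Tensorial

fun reference_element :: "element_type \<Rightarrow> (real^'n) set" where
  "reference_element Simplicial = convex hull (insert 0 (range (\<lambda>i. axis i 1)))"
| "reference_element Tensorial = cbox 0 1"

fun reference_functions :: "element_type \<Rightarrow> (real^'n \<Rightarrow> real) set" where
  "reference_functions Simplicial = {w. \<exists>c g. \<forall>\<xi>. w \<xi> = c + g \<bullet> \<xi>}"
| "reference_functions Tensorial =
     {w. \<exists>c :: 'n set \<Rightarrow> real. \<forall>\<xi>. w \<xi> = (\<Sum>A\<in>UNIV. c A * (\<Prod>i\<in>A. \<xi> $ i))}"

definition element_map :: "element_type \<Rightarrow> (real^'n \<Rightarrow> real^'n) \<Rightarrow> bool" where
  "element_map ty F \<longleftrightarrow> (\<forall>i. (\<lambda>\<xi>. F \<xi> $ i) \<in> reference_functions ty) \<and>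
     inj_on F (reference_element ty) \<and>
     (\<forall>\<xi>\<in>reference_element ty. inj (frechet_derivative F (at \<xi>)))"

definition mesh :: "element_type \<Rightarrow> (real^'n) set \<Rightarrow> (real^'n \<Rightarrow> real^'n) set \<Rightarrow> bool" where
  "mesh ty \<Omega> \<T> \<longleftrightarrow> finite \<T> \<and> (\<forall>F\<in>\<T>. element_map ty F) \<and>
     (\<Union>F\<in>\<T>. F ` reference_element ty) = closure \<Omega> \<and>
     pairwise (\<lambda>F G. disjnt (interior (F ` reference_element ty))
                            (interior (G ` reference_element ty))) \<T>"

definition mesh_vertices :: "element_type \<Rightarrow> (real^'n \<Rightarrow> real^'n) set \<Rightarrow> (real^'n) set" where
  "mesh_vertices ty \<T> = (\<Union>F\<in>\<T>. F ` {\<xi>. \<xi> extreme_point_of reference_element ty})"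

text \<open>The edges and, for \<open>d = 3\<close>, the two-dimensional faces of the reference element. Those of an
  element are their images.\<close>

definition reference_sides :: "element_type \<Rightarrow> (real^'n) set set" where
  "reference_sides ty =
     {s. s face_of reference_element ty \<and> 1 \<le> aff_dim s \<and> aff_dim s < int CARD('n)}"

definition side_center :: "(real^'n) set \<Rightarrow> real^'n" where
  "side_center s = (let V = {\<xi>. \<xi> extreme_point_of s} in (1 / real (card V)) *\<^sub>R (\<Sum>\<xi>\<in>V. \<xi>))"

definition hanging_vertices :: "element_type \<Rightarrow> (real^'n \<Rightarrow> real^'n) set \<Rightarrow> (real^'n) set" where
  "hanging_vertices ty \<T> =
     {x \<in> mesh_vertices ty \<T>. \<exists>F\<in>\<T>. \<exists>s\<in>reference_sides ty. x \<in> F ` rel_interior s}"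

definition regular_vertices :: "element_type \<Rightarrow> (real^'n \<Rightarrow> real^'n) set \<Rightarrow> (real^'n) set" where
  "regular_vertices ty \<T> = mesh_vertices ty \<T> - hanging_vertices ty \<T>"

definition one_irregular :: "element_type \<Rightarrow> (real^'n \<Rightarrow> real^'n) set \<Rightarrow> bool" where
  "one_irregular ty \<T> \<longleftrightarrow> (\<forall>F\<in>\<T>. \<forall>s\<in>reference_sides ty.
     hanging_vertices ty \<T> \<inter> F ` rel_interior s \<subseteq> {F (side_center s)})"

section \<open>Discrete spaces\<close>

text \<open>Discrete functions are total functions, of which only the values on \<open>closure \<Omega>\<close> matter.
  On a simplex \<open>local_functions\<close> are the affine functions of \<open>x\<close>. On a quadrilateral or hexahedron
  they are multilinear in the reference coordinates (for a box, equivalently, in \<open>x\<close>).\<close>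

definition local_functions ::
    "element_type \<Rightarrow> (real^'n \<Rightarrow> real^'n) \<Rightarrow> (real^'n \<Rightarrow> real) set" where
  "local_functions ty F =
     {v. \<exists>w\<in>reference_functions ty. \<forall>\<xi>\<in>reference_element ty. v (F \<xi>) = w \<xi>}"

definition fe_space ::
    "element_type \<Rightarrow> (real^'n) set \<Rightarrow> (real^'n \<Rightarrow> real^'n) set \<Rightarrow> (real^'n \<Rightarrow> real) set" where
  "fe_space ty \<Omega> \<T> = {v. continuous_on (closure \<Omega>) v \<and> (\<forall>F\<in>\<T>. v \<in> local_functions ty F)}"

text \<open>The regular vertices serve as their own index set.\<close>

definition lagrange_basis :: "element_type \<Rightarrow> (real^'n) set \<Rightarrow> (real^'n \<Rightarrow> real^'n) set \<Rightarrow>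
    (real^'n \<Rightarrow> real^'n \<Rightarrow> real) \<Rightarrow> bool" where
  "lagrange_basis ty \<Omega> \<T> N \<longleftrightarrow> (\<forall>x\<in>regular_vertices ty \<T>. N x \<in> fe_space ty \<Omega> \<T> \<and>
     (\<forall>y\<in>regular_vertices ty \<T>. N x y = (if x = y then 1 else 0)))"

definition dirichlet_trial_space :: "element_type \<Rightarrow> (real^'n) set \<Rightarrow> (real^'n \<Rightarrow> real^'n) set \<Rightarrow>
    (real^'n) set \<Rightarrow> (real^'n \<Rightarrow> real) \<Rightarrow> (real^'n \<Rightarrow> real) set" where
  "dirichlet_trial_space ty \<Omega> \<T> \<Gamma>\<^sub>D g = {v \<in> fe_space ty \<Omega> \<T>. \<forall>x\<in>\<Gamma>\<^sub>D. v x = g x}"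

definition dirichlet_flux_space :: "element_type \<Rightarrow> (real^'n) set \<Rightarrow> (real^'n \<Rightarrow> real^'n) set \<Rightarrow>
    (real^'n) set \<Rightarrow> (real^'n \<Rightarrow> real^'n \<Rightarrow> real) \<Rightarrow> (real^'n \<Rightarrow> real) set" where
  "dirichlet_flux_space ty \<Omega> \<T> \<Gamma>\<^sub>D N =
     {q. \<exists>c. \<forall>y\<in>closure \<Omega>. q y = (\<Sum>x\<in>regular_vertices ty \<T> \<inter> \<Gamma>\<^sub>D. c x * N x y)}"

section \<open>Forms\<close>

text \<open>Discrete functions are differentiable in the interior of every element, hence almost
  everywhere; the value of \<open>grad\<close> elsewhere is irrelevant.\<close>

definition grad :: "(real^'n \<Rightarrow> real) \<Rightarrow> real^'n \<Rightarrow> real^'n" where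
  "grad v x = (THE D. GDERIV v x :> D)"

definition diffusion_form :: "(real^'n) set \<Rightarrow> (real^'n \<Rightarrow> real) \<Rightarrow>
    (real^'n \<Rightarrow> real) \<Rightarrow> (real^'n \<Rightarrow> real) \<Rightarrow> real" where
  "diffusion_form \<Omega> k p v = (LINT x:\<Omega>|lebesgue. k x * (grad p x \<bullet> grad v x))"

definition L2_product :: "(real^'n) measure \<Rightarrow> (real^'n) set \<Rightarrow>
    (real^'n \<Rightarrow> real) \<Rightarrow> (real^'n \<Rightarrow> real) \<Rightarrow> real" where
  "L2_product \<sigma> \<Gamma> u v = (LINT x:\<Gamma>|\<sigma>. u x * v x)"

definition square_integrable_on :: "(real^'n) measure \<Rightarrow> (real^'n) set \<Rightarrow> (real^'n \<Rightarrow> real) \<Rightarrow> bool"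
  where "square_integrable_on \<sigma> \<Gamma> u \<longleftrightarrow>
     set_borel_measurable \<sigma> \<Gamma> u \<and> set_integrable \<sigma> \<Gamma> (\<lambda>x. (u x)\<^sup>2)"

definition neumann_functional :: "(real^'n) measure \<Rightarrow> (real^'n) set \<Rightarrow>
    (real^'n \<Rightarrow> real) \<Rightarrow> (real^'n \<Rightarrow> real) \<Rightarrow> real" where
  "neumann_functional \<sigma> \<Gamma>\<^sub>N h v = (LINT x:\<Gamma>\<^sub>N|\<sigma>. h x * v x)"

end

theory Submission
  imports Defs
begin

text \<open>Global conservation follows by testing with the constant \<open>1\<close>. The Dirichlet nodes are not
  removed from the test space, because the flux \<open>q\<^sub>D\<close> takes the place of the reaction there; hence
  the constants are admissible (\<open>const_in_fe_space\<close>). Hanging vertices do not interfere: they only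
  restrict discrete functions through continuity, which a constant satisfies on every mesh. The
  gradient of \<open>1\<close> vanishes, and with it the diffusion form (\<open>diffusion_form_const\<close>), so the
  discrete equation reduces to the balance of the two boundary integrals.\<close>

lemma const_in_fe_space: "(\<lambda>x :: real^'n. c) \<in> fe_space ty \<Omega> \<T>"
proof -
  have "(\<lambda>\<xi> :: real^'n. c) \<in> reference_functions ty"
  proof (cases ty)
    case Simplicial
    then show ?thesis
      by (simp, intro exI[of _ c] exI[of _ 0]) simp
  next
    case Tensorial
    \<comment> \<open>The constant monomial is the empty product, indexed by \<open>A = {}\<close>.\<close>
    have "c = (\<Sum>A\<in>UNIV. (if A = {} then c else 0) * (\<Prod>i\<in>A. \<xi> $ i))" for \<xi> :: "real^'n"
      by (simp add: if_distrib[of "\<lambda>u. u * _"] cong: if_cong)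
    then show ?thesis
      unfolding Tensorial reference_functions.simps
      by (intro CollectI exI[of _ "\<lambda>A. if A = {} then c else 0"]) blast
  qed
  then show ?thesis
    unfolding fe_space_def local_functions_def by (auto intro!: bexI[of _ "\<lambda>\<xi>. c"])
qed

lemma grad_const: "grad (\<lambda>x. c) x = 0"
  unfolding grad_def
proof (rule the_equality)
  show "GDERIV (\<lambda>x. c) x :> 0"
    by (rule GDERIV_const)
  fix D
  assume "GDERIV (\<lambda>x. c) x :> D"
  then have "(\<lambda>h. h \<bullet> D) = (\<lambda>h. 0)"
    unfolding gderiv_def by (rule has_derivative_unique) (rule has_derivative_const)
  then show "D = 0"
    by (metis inner_eq_zero_iff)
qed

lemma diffusion_form_const: "diffusion_form \<Omega> k p (\<lambda>x. c) = 0"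
  unfolding diffusion_form_def by (simp add: grad_const)

theorem mainTheorem1:
  fixes a b :: "real^'n"
    and \<Omega> \<Omega>\<^sub>f \<Omega>\<^sub>m \<Gamma>\<^sub>D \<Gamma>\<^sub>N :: "(real^'n) set"
    and \<B> :: "(real^'n) set set"
    and k g h :: "real^'n \<Rightarrow> real"
    and k\<^sub>m k\<^sub>f :: real
    and ty :: element_type
    and \<T> :: "(real^'n \<Rightarrow> real^'n) set"
    and N :: "real^'n \<Rightarrow> real^'n \<Rightarrow> real"
    and p q\<^sub>D :: "real^'n \<Rightarrow> real"
  assumes "CARD('n) \<in> {2, 3}"
    and "\<And>i. a $ i < b $ i" and "\<Omega> = box a b"
    and "boundary_decomposition \<Omega> \<Gamma>\<^sub>D \<Gamma>\<^sub>N"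
    and "\<Gamma>\<^sub>D \<in> sets (surface_measure a b)" and "\<Gamma>\<^sub>N \<in> sets (surface_measure a b)"
    and "finite \<B>" and "\<And>B. B \<in> \<B> \<Longrightarrow> is_box B \<and> B \<subseteq> \<Omega>"
    and "\<Omega>\<^sub>f = \<Union>\<B>" and "\<Omega>\<^sub>m = \<Omega> - \<Omega>\<^sub>f"
    and "k\<^sub>m > 0" and "k\<^sub>f > 0"
    and "\<And>x. x \<in> \<Omega>\<^sub>m \<Longrightarrow> k x = k\<^sub>m" and "\<And>x. x \<in> \<Omega>\<^sub>f \<Longrightarrow> k x = k\<^sub>f"
    and "square_integrable_on (surface_measure a b) \<Gamma>\<^sub>N h"
    and "mesh ty \<Omega> \<T>" and "one_irregular ty \<T>"
    and "lagrange_basis ty \<Omega> \<T> N"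
    and "p \<in> dirichlet_trial_space ty \<Omega> \<T> \<Gamma>\<^sub>D g"
    and "q\<^sub>D \<in> dirichlet_flux_space ty \<Omega> \<T> \<Gamma>\<^sub>D N"
    and "\<And>v. v \<in> fe_space ty \<Omega> \<T> \<Longrightarrow>
           diffusion_form \<Omega> k p v - L2_product (surface_measure a b) \<Gamma>\<^sub>D q\<^sub>D v
             = neumann_functional (surface_measure a b) \<Gamma>\<^sub>N h v"
  shows "(LINT x:\<Gamma>\<^sub>D|surface_measure a b. q\<^sub>D x) + (LINT x:\<Gamma>\<^sub>N|surface_measure a b. h x) = 0"
  using assms(21)[OF const_in_fe_space[of 1]]
  by (simp add: diffusion_form_const L2_product_def neumann_functional_def)

end
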